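(* Let $k$ be a field of any characteristic, let $V$ be a finite-dimensional vector space over $k$, let $\varphi:V\to V$ be a linear map and let $w\in V$ be an eigenvector of $\varphi$. For homogeneous elements $f,g$ of the symmetric algebra $S(V^* )=\bigoplus_{d\ge 0}S^d(V^* )$ define $$[f,g]_s:=\begin{cases}0, & \deg(f)\neq\deg(g),\\ g(w)\,\varphi_d^*(f)-f(w)\,\varphi_d^*(g), & \deg(f)=\deg(g)=d,\end{cases}$$ and extend $[-,-]_s$ bilinearly to $S(V^* )$. Then $S(V^* )$ together with the bracket $[-,-]_s$ is a solvable infinite-dimensional Lie algebra over $k$.
   Context: $S^d(V^* )$ denotes the $d$-th symmetric power of the dual space $V^*$. Choosing a basis of $V$ with dual basis $x_1,\dots,x_n$ of $V^*$, it is identified with the space of homogeneous polynomials of degree $d$ in $k[x_1,\dots,x_n]$, and $S(V^* )\cong k[x_1,\dots,x_n]$; elements $f$ are evaluated at vectors $v\in V$, giving $f(v)\in k$. For a linear map $\varphi:V\to V$, $\varphi_d^*:S^d(V^* )\to S^d(V^* )$ denotes the linear map induced by $\varphi$, i.e. $\varphi_d^*(f)=f\circ\varphi$, $\varphi_d^*(f)(v)=f(\varphi(v))$ for all $v\in V$ (as polynomials, it is given by substituting $x_i\mapsto x_i\circ\varphi\in V^*$). *)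

theory Defs
  imports Complex_Main "HOL-Library.Poly_Mapping"
begin

section \<open>Lie algebras\<close>

text \<open>
  A Lie algebra over the field \<open>'k\<close> whose underlying vector space is a subspace \<open>L\<close> of a
  vector space type. The bracket is required to be alternating (not merely antisymmetric),
  which matters in characteristic 2.
\<close>

locale lie_algebra = vector_space scale
  for scale :: "'k::field \<Rightarrow> 'a::ab_group_add \<Rightarrow> 'a" +
  fixes L :: "'a set"
    and bracket :: "'a \<Rightarrow> 'a \<Rightarrow> 'a"
  assumes subspace_L: "subspace L"
    and bracket_closed: "x \<in> L \<Longrightarrow> y \<in> L \<Longrightarrow> bracket x y \<in> L"
    and bracket_add_left: "x \<in> L \<Longrightarrow> y \<in> L \<Longrightarrow> z \<in> L \<Longrightarrow> bracket (x + y) z = bracket x z + bracket y z"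
    and bracket_add_right: "x \<in> L \<Longrightarrow> y \<in> L \<Longrightarrow> z \<in> L \<Longrightarrow> bracket x (y + z) = bracket x y + bracket x z"
    and bracket_scale_left: "x \<in> L \<Longrightarrow> y \<in> L \<Longrightarrow> bracket (scale c x) y = scale c (bracket x y)"
    and bracket_scale_right: "x \<in> L \<Longrightarrow> y \<in> L \<Longrightarrow> bracket x (scale c y) = scale c (bracket x y)"
    and bracket_self: "x \<in> L \<Longrightarrow> bracket x x = 0"
    and jacobi: "x \<in> L \<Longrightarrow> y \<in> L \<Longrightarrow> z \<in> L \<Longrightarrow>
      bracket x (bracket y z) + bracket y (bracket z x) + bracket z (bracket x y) = 0"
begin

primrec derived_series :: "nat \<Rightarrow> 'a set" where
  "derived_series 0 = L"
| "derived_series (Suc n) = span {bracket x y | x y. x \<in> derived_series n \<and> y \<in> derived_series n}"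

definition solvable :: bool where
  "solvable \<longleftrightarrow> (\<exists>n. derived_series n = {0})"

definition infinite_dimensional :: bool where
  "infinite_dimensional \<longleftrightarrow> \<not> (\<exists>B. finite B \<and> B \<subseteq> L \<and> span B = L)"

end

section \<open>The symmetric algebra of the dual space\<close>

text \<open>
  A vector space \<open>V\<close> is given by its scalar multiplication \<open>scale\<close> on the type \<open>'v\<close> and a finite
  basis \<open>Basis\<close>. The symmetric algebra of the dual space is identified with the polynomial ring
  in the dual basis, the variable \<open>x\<^sub>b\<close> (for \<open>b\<close> in \<open>Basis\<close>) being the coordinate functional
  \<open>v \<mapsto> representation Basis v b\<close>. A monomial is a finitely supported exponent map on the
  variables, and a polynomial is a finitely supported coefficient map on the monomials.
\<close>

type_synonym ('v, 'k) polynomial = "('v \<Rightarrow>\<^sub>0 nat) \<Rightarrow>\<^sub>0 'k"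

definition sym_dual :: "'v set \<Rightarrow> ('v, 'k::field) polynomial set" where
  "sym_dual Basis = {p. \<forall>m\<in>Poly_Mapping.keys p. Poly_Mapping.keys m \<subseteq> Basis}"

definition poly_scale :: "'k::field \<Rightarrow> ('v, 'k) polynomial \<Rightarrow> ('v, 'k) polynomial" where
  "poly_scale c p = Poly_Mapping.map ((*) c) p"

definition monom_degree :: "('v \<Rightarrow>\<^sub>0 nat) \<Rightarrow> nat" where
  "monom_degree m = (\<Sum>b\<in>Poly_Mapping.keys m. Poly_Mapping.lookup m b)"

definition sym_dual_degree :: "'v set \<Rightarrow> nat \<Rightarrow> ('v, 'k::field) polynomial set" where
  "sym_dual_degree Basis d = {p \<in> sym_dual Basis. \<forall>m\<in>Poly_Mapping.keys p. monom_degree m = d}"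

definition degrees :: "('v, 'k::field) polynomial \<Rightarrow> nat set" where
  "degrees p = monom_degree ` Poly_Mapping.keys p"

definition hom_component :: "nat \<Rightarrow> ('v, 'k::field) polynomial \<Rightarrow> ('v, 'k) polynomial" where
  "hom_component d p =
    (\<Sum>m\<in>{m \<in> Poly_Mapping.keys p. monom_degree m = d}. Poly_Mapping.single m (Poly_Mapping.lookup p m))"

text \<open>
  Substitution of \<open>\<sigma> b\<close> for the variable \<open>x\<^sub>b\<close>, with coefficients sent along \<open>h\<close>.
\<close>

definition poly_subst ::
  "('k::field \<Rightarrow> 'r::comm_ring_1) \<Rightarrow> ('v \<Rightarrow> 'r) \<Rightarrow> ('v, 'k) polynomial \<Rightarrow> 'r" where
  "poly_subst h \<sigma> p =
    (\<Sum>m\<in>Poly_Mapping.keys p. h (Poly_Mapping.lookup p m) *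
       (\<Prod>b\<in>Poly_Mapping.keys m. \<sigma> b ^ Poly_Mapping.lookup m b))"

definition poly_at :: "('k::field \<Rightarrow> 'v::ab_group_add \<Rightarrow> 'v) \<Rightarrow> 'v set \<Rightarrow> ('v, 'k) polynomial \<Rightarrow> 'v \<Rightarrow> 'k" where
  "poly_at scale Basis p v = poly_subst (\<lambda>c. c) (module.representation scale Basis v) p"

text \<open>
  The element of the dual space with value \<open>l b\<close> at each basis vector \<open>b\<close>, as a linear form in
  the variables.
\<close>

definition linear_form :: "'v set \<Rightarrow> ('v \<Rightarrow> 'k::field) \<Rightarrow> ('v, 'k) polynomial" where
  "linear_form Basis l = (\<Sum>c\<in>Basis. Poly_Mapping.single (Poly_Mapping.single c 1) (l c))"

text \<open>
  The map \<open>\<phi>\<^sup>*\<close> on the whole symmetric algebra, substituting the functional \<open>x\<^sub>b \<circ> \<phi>\<close> for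
  \<open>x\<^sub>b\<close>; its restriction to degree \<open>d\<close> is the map induced on the \<open>d\<close>-th symmetric power.
\<close>

definition pullback :: "('k::field \<Rightarrow> 'v::ab_group_add \<Rightarrow> 'v) \<Rightarrow> 'v set \<Rightarrow> ('v \<Rightarrow> 'v) \<Rightarrow>
    ('v, 'k) polynomial \<Rightarrow> ('v, 'k) polynomial" where
  "pullback scale Basis \<phi> p = poly_subst (Poly_Mapping.single 0)
     (\<lambda>b. linear_form Basis (\<lambda>c. module.representation scale Basis (\<phi> c) b)) p"

text \<open>
  The bracket of \<open>f\<close> homogeneous of degree \<open>d\<close> and \<open>g\<close> homogeneous of degree \<open>e\<close>. The degrees
  are arguments because the zero polynomial has no degree of its own.
\<close>

definition hom_bracket :: "('k::field \<Rightarrow> 'v::ab_group_add \<Rightarrow> 'v) \<Rightarrow> 'v set \<Rightarrow> ('v \<Rightarrow> 'v) \<Rightarrow> 'v \<Rightarrow>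
    nat \<Rightarrow> nat \<Rightarrow> ('v, 'k) polynomial \<Rightarrow> ('v, 'k) polynomial \<Rightarrow> ('v, 'k) polynomial" where
  "hom_bracket scale Basis \<phi> w d e f g =
    (if d \<noteq> e then 0
     else poly_scale (poly_at scale Basis g w) (pullback scale Basis \<phi> f)
        - poly_scale (poly_at scale Basis f w) (pullback scale Basis \<phi> g))"

text \<open>The bilinear extension to all polynomials.\<close>

definition sym_bracket :: "('k::field \<Rightarrow> 'v::ab_group_add \<Rightarrow> 'v) \<Rightarrow> 'v set \<Rightarrow> ('v \<Rightarrow> 'v) \<Rightarrow> 'v \<Rightarrow>
    ('v, 'k) polynomial \<Rightarrow> ('v, 'k) polynomial \<Rightarrow> ('v, 'k) polynomial" where
  "sym_bracket scale Basis \<phi> w f g =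
    (\<Sum>d\<in>degrees f. \<Sum>e\<in>degrees g.
       hom_bracket scale Basis \<phi> w d e (hom_component d f) (hom_component e g))"

section \<open>Consistency of the definitions\<close>

lemma poly_eq_sum_single:
  "(\<Sum>m\<in>Poly_Mapping.keys p. Poly_Mapping.single m (Poly_Mapping.lookup p m)) = p"
  by (rule poly_mapping_eqI)
    (auto simp: lookup_sum lookup_single when_def sum.delta in_keys_iff)

lemma hom_component_homogeneous:
  assumes "p \<in> sym_dual_degree Basis d"
  shows "hom_component d p = p"
proof -
  have "{m \<in> Poly_Mapping.keys p. monom_degree m = d} = Poly_Mapping.keys p"
    using assms by (auto simp: sym_dual_degree_def)
  then show ?thesis
    by (simp add: hom_component_def poly_eq_sum_single)
qed

lemma sym_bracket_homogeneous:
  fixes f g :: "('v::ab_group_add, 'k::field) polynomial"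
  assumes f: "f \<in> sym_dual_degree Basis d" and g: "g \<in> sym_dual_degree Basis e"
  shows "sym_bracket scale Basis \<phi> w f g = hom_bracket scale Basis \<phi> w d e f g"
proof (cases "f = 0 \<or> g = 0")
  case True
  have "poly_scale c (0 :: ('v, 'k) polynomial) = 0" "poly_scale 0 p = 0"
    for c :: 'k and p :: "('v, 'k) polynomial"
    by (simp_all add: poly_scale_def mult_map_scale_conv_mult)
  with True show ?thesis
    by (auto simp: sym_bracket_def hom_bracket_def degrees_def pullback_def poly_at_def
        poly_subst_def)
next
  case False
  then have "Poly_Mapping.keys f \<noteq> {}" "Poly_Mapping.keys g \<noteq> {}"
    by (metis poly_eq_sum_single sum.empty)+
  moreover have "degrees f \<subseteq> {d}" "degrees g \<subseteq> {e}"
    using f g by (auto simp: degrees_def sym_dual_degree_def)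
  ultimately have "degrees f = {d}" "degrees g = {e}"
    by (auto simp: degrees_def subset_singleton_iff)
  then show ?thesis
    by (simp add: sym_bracket_def hom_component_homogeneous[OF f] hom_component_homogeneous[OF g])
qed

lemma vector_space_poly_scale: "vector_space (poly_scale :: 'k::field \<Rightarrow> ('v, 'k) polynomial \<Rightarrow> _)"
  by unfold_locales
    (simp_all add: poly_scale_def mult_map_scale_conv_mult algebra_simps single_add mult_single
      flip: mult.assoc)

lemma poly_subst_superset:
  assumes "finite M" "Poly_Mapping.keys p \<subseteq> M" "h 0 = 0"
  shows "poly_subst h \<sigma> p = (\<Sum>m\<in>M. h (Poly_Mapping.lookup p m) *
       (\<Prod>b\<in>Poly_Mapping.keys m. \<sigma> b ^ Poly_Mapping.lookup m b))"
  unfolding poly_subst_def using assms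
  by (intro sum.mono_neutral_left) (auto simp: in_keys_iff)

lemma poly_subst_add:
  assumes "h 0 = 0" "\<And>a b. h (a + b) = h a + h b"
  shows "poly_subst h \<sigma> (p + q) = poly_subst h \<sigma> p + poly_subst h \<sigma> q"
proof -
  define M where "M = Poly_Mapping.keys p \<union> Poly_Mapping.keys q"
  have M: "finite M" "Poly_Mapping.keys p \<subseteq> M" "Poly_Mapping.keys q \<subseteq> M"
    "Poly_Mapping.keys (p + q) \<subseteq> M"
    using keys_add[of p q] by (auto simp: M_def)
  show ?thesis
    unfolding poly_subst_superset[of M p h \<sigma>, OF M(1,2) assms(1)]
      poly_subst_superset[of M q h \<sigma>, OF M(1,3) assms(1)]
      poly_subst_superset[of M "p + q" h \<sigma>, OF M(1,4) assms(1)]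
    by (simp add: assms(2) lookup_add sum.distrib distrib_right)
qed

lemma poly_subst_sum:
  assumes "h 0 = 0" "\<And>a b. h (a + b) = h a + h b"
  shows "poly_subst h \<sigma> (\<Sum>i\<in>A. p i) = (\<Sum>i\<in>A. poly_subst h \<sigma> (p i))"
  by (induction A rule: infinite_finite_induct)
    (simp_all add: poly_subst_add assms, simp_all add: poly_subst_def)

lemma monom_subst_superset:
  assumes "finite M" "Poly_Mapping.keys m \<subseteq> M"
  shows "(\<Prod>b\<in>Poly_Mapping.keys m. (\<sigma> b :: 'r::comm_ring_1) ^ Poly_Mapping.lookup m b) =
    (\<Prod>b\<in>M. \<sigma> b ^ Poly_Mapping.lookup m b)"
  using assms by (intro prod.mono_neutral_left) (auto simp: in_keys_iff)

lemma monom_subst_add: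
  fixes \<sigma> :: "'v \<Rightarrow> 'r::comm_ring_1"
  shows "(\<Prod>b\<in>Poly_Mapping.keys (m + n). \<sigma> b ^ Poly_Mapping.lookup (m + n) b) =
    (\<Prod>b\<in>Poly_Mapping.keys m. \<sigma> b ^ Poly_Mapping.lookup m b) *
    (\<Prod>b\<in>Poly_Mapping.keys n. \<sigma> b ^ Poly_Mapping.lookup n b)"
proof -
  define M where "M = Poly_Mapping.keys m \<union> Poly_Mapping.keys n"
  have M: "finite M" "Poly_Mapping.keys m \<subseteq> M" "Poly_Mapping.keys n \<subseteq> M"
    "Poly_Mapping.keys (m + n) \<subseteq> M"
    using keys_add[of m n] by (auto simp: M_def)
  show ?thesis
    unfolding monom_subst_superset[OF M(1,2), of \<sigma>] monom_subst_superset[OF M(1,3), of \<sigma>]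
      monom_subst_superset[OF M(1,4), of \<sigma>]
    by (simp add: lookup_add power_add prod.distrib)
qed

lemma poly_subst_single:
  assumes "h 0 = 0"
  shows "poly_subst h \<sigma> (Poly_Mapping.single m a) =
    h a * (\<Prod>b\<in>Poly_Mapping.keys m. \<sigma> b ^ Poly_Mapping.lookup m b)"
  using assms by (simp add: poly_subst_def)

lemma poly_subst_mult:
  assumes h: "h 0 = 0" "\<And>a b. h (a + b) = h a + h b" "\<And>a b. h (a * b) = h a * h b"
  shows "poly_subst h \<sigma> (p * q) = poly_subst h \<sigma> p * poly_subst h \<sigma> q"
proof -
  let ?c = Poly_Mapping.lookup and ?s = Poly_Mapping.single
  have "p * q = (\<Sum>m\<in>Poly_Mapping.keys p. ?s m (?c p m)) * (\<Sum>n\<in>Poly_Mapping.keys q. ?s n (?c q n))"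
    by (simp only: poly_eq_sum_single)
  also have "\<dots> = (\<Sum>m\<in>Poly_Mapping.keys p. \<Sum>n\<in>Poly_Mapping.keys q. ?s (m + n) (?c p m * ?c q n))"
    by (simp add: sum_product mult_single)
  finally have "poly_subst h \<sigma> (p * q) =
      (\<Sum>m\<in>Poly_Mapping.keys p. \<Sum>n\<in>Poly_Mapping.keys q. poly_subst h \<sigma> (?s (m + n) (?c p m * ?c q n)))"
    by (simp add: poly_subst_sum h)
  also have "\<dots> = poly_subst h \<sigma> p * poly_subst h \<sigma> q"
    unfolding poly_subst_single[of h, OF h(1)] monom_subst_add h(3) poly_subst_def[of h \<sigma> p]
      poly_subst_def[of h \<sigma> q] sum_product
    by (intro sum.cong refl) (simp add: mult_ac)
  finally show ?thesis .
qed

text \<open>As a function on vectors, \<open>\<phi>\<^sup>* p\<close> is \<open>p \<circ> \<phi>\<close>.\<close>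

lemma (in finite_dimensional_vector_space) poly_at_pullback:
  assumes "Vector_Spaces.linear scale scale \<phi>" and p: "p \<in> sym_dual Basis"
  shows "poly_at scale Basis (pullback scale Basis \<phi> p) v = poly_at scale Basis p (\<phi> v)"
proof -
  interpret \<phi>: Vector_Spaces.linear scale scale \<phi> by fact
  let ?E = "poly_subst (\<lambda>c::'a. c) (representation Basis v)"
  have one: "?E 1 = 1"
    by (simp flip: single_one add: poly_subst_single)
  have mult: "?E (f * g) = ?E f * ?E g" for f g
    by (simp add: poly_subst_mult)
  have power: "?E (f ^ n) = ?E f ^ n" for f n
    by (induction n) (simp_all add: one mult)
  have prod: "?E (\<Prod>i\<in>A. f i) = (\<Prod>i\<in>A. ?E (f i))" for f and A :: "'b set"
    by (induction A rule: infinite_finite_induct) (simp_all add: one mult)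
  have rep: "representation Basis (\<phi> v) b =
      (\<Sum>c\<in>Basis. representation Basis (\<phi> c) b * representation Basis v c)" if "b \<in> Basis" for b
  proof -
    have "\<phi> v = \<phi> (\<Sum>c\<in>Basis. scale (representation Basis v c) c)"
      using sum_representation_eq[OF independent_Basis _ finite_Basis order_refl, of v]
      by (simp add: span_Basis)
    also have "\<dots> = (\<Sum>c\<in>Basis. scale (representation Basis v c) (\<phi> c))"
      by (simp add: \<phi>.sum \<phi>.scale)
    finally show ?thesis
      by (simp add: representation_sum representation_scale independent_Basis span_Basis mult.commute)
  qed
  have form: "?E (linear_form Basis (\<lambda>c. representation Basis (\<phi> c) b)) =
      representation Basis (\<phi> v) b" if "b \<in> Basis" for b
    using that by (simp add: linear_form_def poly_subst_sum poly_subst_single rep)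
  have "?E (pullback scale Basis \<phi> p) = (\<Sum>m\<in>Poly_Mapping.keys p. Poly_Mapping.lookup p m *
      (\<Prod>b\<in>Poly_Mapping.keys m.
        ?E (linear_form Basis (\<lambda>c. representation Basis (\<phi> c) b)) ^ Poly_Mapping.lookup m b))"
    unfolding pullback_def
    by (subst (2) poly_subst_def) (simp add: poly_subst_sum mult prod power poly_subst_single)
  also have "\<dots> = poly_subst (\<lambda>c. c) (representation Basis (\<phi> v)) p"
    unfolding poly_subst_def[of _ "representation Basis (\<phi> v)"] using p
    by (intro sum.cong refl arg_cong2[where f = times] prod.cong)
      (auto simp: sym_dual_def intro!: form arg_cong2[where f = power])
  finally show ?thesis
    by (simp add: poly_at_def)
qed

end

theory Submission
  imports Defs
begin

text \<open>
  On \<open>S\<^sup>d(V\<^sup>*)\<close> write \<open>A\<close> for \<open>\<phi>\<^sub>d\<^sup>*\<close> and \<open>\<epsilon>\<close> for evaluation at \<open>w\<close>, so that the bracket is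
  \<open>[f, g] = \<epsilon>(g) A f - \<epsilon>(f) A g\<close>. If \<open>\<phi> w = c w\<close>, then \<open>\<epsilon>(A f) = f(\<phi> w) = f(c w) = c\<^sup>d \<epsilon>(f)\<close>;
  that is, \<open>\<epsilon>\<close> is an eigenvector of the transpose of \<open>A\<close>. This gives
  \<open>\<epsilon>([f, g]) = c\<^sup>d (\<epsilon>(g) \<epsilon>(f) - \<epsilon>(f) \<epsilon>(g)) = 0\<close> (lemma \<open>eval_at_bracket\<close>), and the
  Jacobi identity and solvability both follow from this equation.

  For the Jacobi identity, \<open>\<epsilon>([g, h]) = 0\<close> leaves
  \<open>[f, [g, h]] = - \<epsilon>(f) A [g, h] = \<epsilon>(f) \<epsilon>(g) A\<^sup>2 h - \<epsilon>(f) \<epsilon>(h) A\<^sup>2 g\<close>,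
  and the sum over the cyclic permutations of \<open>f, g, h\<close> cancels. For solvability, the derived algebra lies
  in the kernel of \<open>\<epsilon>\<close>, where the bracket vanishes, so the second derived algebra is zero.

  The bracket on the whole of \<open>S(V\<^sup>*)\<close> acts separately in each degree (lemma
  \<open>hom_component_bracket\<close>), because \<open>\<phi>\<^sup>*\<close> preserves degrees, and a polynomial is determined by its
  homogeneous components. The argument above therefore applies in each degree.

  The algebra has infinite dimension because finitely many polynomials span only polynomials whose terms
  have degrees in a finite set, whereas \<open>w \<noteq> 0\<close> provides a variable, which has powers of every degree.
\<close>

section \<open>Homogeneous components\<close>

global_interpretation poly: vector_space "poly_scale :: 'k::field \<Rightarrow> ('v, 'k) polynomial \<Rightarrow> _"
  by (rule vector_space_poly_scale)

lemma poly_scale_conv_mult: "poly_scale c p = Poly_Mapping.single 0 c * p"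
  by (simp add: poly_scale_def mult_map_scale_conv_mult)

lemma lookup_poly_scale: "Poly_Mapping.lookup (poly_scale c p) m = c * Poly_Mapping.lookup p m"
  by (simp add: poly_scale_def Poly_Mapping.map.rep_eq when_def)

lemma lookup_hom_component:
  "Poly_Mapping.lookup (hom_component d p) m = (if monom_degree m = d then Poly_Mapping.lookup p m else 0)"
  by (auto simp: hom_component_def lookup_sum lookup_single when_def sum.delta in_keys_iff)

text \<open>
  This reduces each identity between brackets to its degree \<open>d\<close> part, where \<open>hom_component_bracket\<close>
  gives an explicit formula.
\<close>

lemma poly_eqI_hom_component:
  assumes "\<And>d. hom_component d p = hom_component d q"
  shows "p = q"
proof (rule poly_mapping_eqI)
  fix m
  have "Poly_Mapping.lookup (hom_component (monom_degree m) p) m =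
      Poly_Mapping.lookup (hom_component (monom_degree m) q) m"
    by (simp only: assms)
  then show "Poly_Mapping.lookup p m = Poly_Mapping.lookup q m"
    by (simp add: lookup_hom_component)
qed

lemma hom_component_linear [simp]:
  "hom_component d 0 = 0"
  "hom_component d (p + q) = hom_component d p + hom_component d q"
  "hom_component d (p - q) = hom_component d p - hom_component d q"
  "hom_component d (poly_scale c p) = poly_scale c (hom_component d p)"
  by (rule poly_mapping_eqI, simp add: lookup_hom_component lookup_add lookup_minus lookup_poly_scale)+

lemma hom_component_sum: "hom_component d (\<Sum>i\<in>I. p i) = (\<Sum>i\<in>I. hom_component d (p i))"
  by (induction I rule: infinite_finite_induct) simp_all

lemma hom_component_eq_0_iff: "hom_component d p = 0 \<longleftrightarrow> d \<notin> degrees p"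
  by (auto simp: poly_mapping_eq_iff fun_eq_iff lookup_hom_component degrees_def in_keys_iff)

lemma finite_degrees: "finite (degrees p)"
  by (simp add: degrees_def)

lemma subspace_degrees: "poly.subspace {p :: ('v, 'k::field) polynomial. degrees p \<subseteq> D}"
proof -
  have "{p :: ('v, 'k) polynomial. degrees p \<subseteq> D} = {p. \<forall>d. d \<notin> D \<longrightarrow> hom_component d p = 0}"
    by (auto simp: hom_component_eq_0_iff)
  then show ?thesis
    by (simp add: poly.subspace_def)
qed

lemma subspace_sym_dual: "poly.subspace (sym_dual Basis :: ('v, 'k::field) polynomial set)"
proof -
  have "(sym_dual Basis :: ('v, 'k) polynomial set) = {p. \<forall>m. \<not> Poly_Mapping.keys m \<subseteq> Basis \<longrightarrow> Poly_Mapping.lookup p m = 0}"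
    by (auto simp: sym_dual_def in_keys_iff)
  then show ?thesis
    by (auto simp: poly.subspace_def lookup_add lookup_poly_scale)
qed

lemma sym_dual_degree_iff:
  "p \<in> sym_dual_degree Basis d \<longleftrightarrow> p \<in> sym_dual Basis \<and> degrees p \<subseteq> {d}"
  by (auto simp: sym_dual_degree_def degrees_def)

lemma subspace_sym_dual_degree:
  "poly.subspace (sym_dual_degree Basis d :: ('v, 'k::field) polynomial set)"
proof -
  have "(sym_dual_degree Basis d :: ('v, 'k) polynomial set) = sym_dual Basis \<inter> {p. degrees p \<subseteq> {d}}"
    by (auto simp: sym_dual_degree_iff)
  then show ?thesis
    by (simp add: poly.subspace_inter subspace_sym_dual subspace_degrees)
qed

lemma hom_component_in_sym_dual_degree:
  "p \<in> sym_dual Basis \<Longrightarrow> hom_component d p \<in> sym_dual_degree Basis d"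
  by (auto simp: sym_dual_degree_def sym_dual_def in_keys_iff lookup_hom_component split: if_splits)

lemma hom_component_of_homogeneous:
  "p \<in> sym_dual_degree Basis e \<Longrightarrow> hom_component d p = (if e = d then p else 0)"
  by (auto simp: hom_component_homogeneous sym_dual_degree_iff hom_component_eq_0_iff)

lemma single_in_sym_dual_degree:
  "Poly_Mapping.keys m \<subseteq> Basis \<Longrightarrow> monom_degree m = d \<Longrightarrow>
    Poly_Mapping.single m a \<in> sym_dual_degree Basis d"
  by (auto simp: sym_dual_degree_def sym_dual_def)

section \<open>Products and substitution\<close>

lemma monom_degree_add: "monom_degree (m + n) = monom_degree m + monom_degree n"
proof -
  define M where "M = Poly_Mapping.keys m \<union> Poly_Mapping.keys n"
  have "monom_degree l = (\<Sum>b\<in>M. Poly_Mapping.lookup l b)" if "Poly_Mapping.keys l \<subseteq> M" for l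
    unfolding monom_degree_def using that
    by (intro sum.mono_neutral_left) (auto simp: M_def in_keys_iff)
  then show ?thesis
    using keys_add[of m n] by (simp add: M_def lookup_add sum.distrib)
qed

lemma mult_in_sym_dual_degree:
  assumes "p \<in> sym_dual_degree Basis d" "q \<in> sym_dual_degree Basis e"
  shows "p * q \<in> sym_dual_degree Basis (d + e)"
proof -
  have "Poly_Mapping.keys l \<subseteq> Basis \<and> monom_degree l = d + e" if l: "l \<in> Poly_Mapping.keys (p * q)" for l
  proof -
    obtain m n where "l = m + n" "m \<in> Poly_Mapping.keys p" "n \<in> Poly_Mapping.keys q"
      using l keys_mult[of p q] by blast
    then show ?thesis
      using assms keys_add[of m n]
      by (fastforce simp: sym_dual_degree_def sym_dual_def monom_degree_add)
  qed
  then show ?thesis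
    by (auto simp: sym_dual_degree_def sym_dual_def)
qed

lemma one_in_sym_dual_degree: "1 \<in> sym_dual_degree Basis 0"
  unfolding single_one[symmetric]
  by (rule single_in_sym_dual_degree) (simp_all add: monom_degree_def)

lemma power_in_sym_dual_degree:
  "p \<in> sym_dual_degree Basis d \<Longrightarrow> p ^ n \<in> sym_dual_degree Basis (n * d)"
  by (induction n) (simp_all add: one_in_sym_dual_degree mult_in_sym_dual_degree)

lemma prod_in_sym_dual_degree:
  "(\<And>i. i \<in> I \<Longrightarrow> p i \<in> sym_dual_degree Basis (d i)) \<Longrightarrow>
    (\<Prod>i\<in>I. p i) \<in> sym_dual_degree Basis (\<Sum>i\<in>I. d i)"
  by (induction I rule: infinite_finite_induct)
    (simp_all add: one_in_sym_dual_degree mult_in_sym_dual_degree)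

lemma linear_form_in_sym_dual_degree: "linear_form Basis l \<in> sym_dual_degree Basis 1"
  unfolding linear_form_def
  by (intro poly.subspace_sum subspace_sym_dual_degree single_in_sym_dual_degree)
    (simp_all add: monom_degree_def)

lemma pullback_in_sym_dual_degree:
  assumes "p \<in> sym_dual_degree Basis d"
  shows "pullback scale Basis \<phi> p \<in> sym_dual_degree Basis d"
  unfolding pullback_def poly_subst_def poly_scale_conv_mult[symmetric]
proof (intro poly.subspace_sum poly.subspace_scale subspace_sym_dual_degree)
  fix m
  assume "m \<in> Poly_Mapping.keys p"
  then have "d = (\<Sum>b\<in>Poly_Mapping.keys m. Poly_Mapping.lookup m b * 1)"
    using assms by (simp add: sym_dual_degree_def monom_degree_def)
  then show "(\<Prod>b\<in>Poly_Mapping.keys m.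
      linear_form Basis (\<lambda>c. module.representation scale Basis (\<phi> c) b) ^ Poly_Mapping.lookup m b)
      \<in> sym_dual_degree Basis d"
    by (simp only:) (intro prod_in_sym_dual_degree power_in_sym_dual_degree linear_form_in_sym_dual_degree)
qed

lemma poly_subst_poly_scale:
  assumes "h 0 = 0" "\<And>a b. h (a + b) = h a + h b" "\<And>a b. h (a * b) = h a * h b"
  shows "poly_subst h \<sigma> (poly_scale c p) = h c * poly_subst h \<sigma> p"
  by (simp add: poly_scale_conv_mult poly_subst_mult poly_subst_single assms)

lemma pullback_linear [simp]:
  "pullback scale Basis \<phi> 0 = 0"
  "pullback scale Basis \<phi> (p + q) = pullback scale Basis \<phi> p + pullback scale Basis \<phi> q"
  "pullback scale Basis \<phi> (poly_scale a p) = poly_scale a (pullback scale Basis \<phi> p)"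
  by (simp_all add: pullback_def poly_subst_add poly_subst_poly_scale single_add mult_single
      flip: poly_scale_conv_mult) (simp add: poly_subst_def)

lemma pullback_diff [simp]:
  "pullback scale Basis \<phi> (p - q) = pullback scale Basis \<phi> p - pullback scale Basis \<phi> q"
  using pullback_linear(2)[of scale Basis \<phi> "p - q" q] by (simp add: algebra_simps)

lemma poly_at_linear [simp]:
  "poly_at scale Basis 0 v = 0"
  "poly_at scale Basis (p + q) v = poly_at scale Basis p v + poly_at scale Basis q v"
  "poly_at scale Basis (poly_scale a p) v = a * poly_at scale Basis p v"
  by (simp_all add: poly_at_def poly_subst_add poly_subst_poly_scale) (simp add: poly_subst_def)

lemma poly_at_diff [simp]:
  "poly_at scale Basis (p - q) v = poly_at scale Basis p v - poly_at scale Basis q v"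
  using poly_at_linear(2)[of scale Basis "p - q" q v] by (simp add: algebra_simps)

lemma (in finite_dimensional_vector_space) poly_at_scale_homogeneous:
  assumes "p \<in> sym_dual_degree Basis d"
  shows "poly_at scale Basis p (scale c v) = c ^ d * poly_at scale Basis p v"
proof -
  have "(\<Prod>b\<in>Poly_Mapping.keys m. representation Basis (scale c v) b ^ Poly_Mapping.lookup m b) =
      c ^ d * (\<Prod>b\<in>Poly_Mapping.keys m. representation Basis v b ^ Poly_Mapping.lookup m b)"
    if "m \<in> Poly_Mapping.keys p" for m
  proof -
    have "monom_degree m = d"
      using assms that by (simp add: sym_dual_degree_def)
    then show ?thesis
      by (auto simp: representation_scale independent_Basis span_Basis power_mult_distrib
          prod.distrib monom_degree_def power_sum)
  qed
  then show ?thesis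
    by (simp add: poly_at_def poly_subst_def sum_distrib_left mult_ac)
qed

section \<open>The bracket at an eigenvector\<close>

locale eigenvector_bracket = finite_dimensional_vector_space scale Basis
  for scale :: "'k::field \<Rightarrow> 'v::ab_group_add \<Rightarrow> 'v" and Basis :: "'v set" +
  fixes \<phi> :: "'v \<Rightarrow> 'v" and w :: 'v and c :: 'k
  assumes linear_map: "Vector_Spaces.linear scale scale \<phi>"
    and eigen: "\<phi> w = scale c w"
begin

abbreviation pull :: "('v, 'k) polynomial \<Rightarrow> ('v, 'k) polynomial" where
  "pull \<equiv> pullback scale Basis \<phi>"

abbreviation bracket :: "('v, 'k) polynomial \<Rightarrow> ('v, 'k) polynomial \<Rightarrow> ('v, 'k) polynomial" where
  "bracket \<equiv> sym_bracket scale Basis \<phi> w"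

definition eval_at :: "nat \<Rightarrow> ('v, 'k) polynomial \<Rightarrow> 'k" where
  "eval_at d p = poly_at scale Basis (hom_component d p) w"

lemma eval_at_linear [simp]:
  "eval_at d 0 = 0"
  "eval_at d (p + q) = eval_at d p + eval_at d q"
  "eval_at d (poly_scale a p) = a * eval_at d p"
  by (simp_all add: eval_at_def)

lemma bracket_in_sym_dual:
  assumes "f \<in> sym_dual Basis" "g \<in> sym_dual Basis"
  shows "bracket f g \<in> sym_dual Basis"
proof -
  have "pull (hom_component d p) \<in> sym_dual Basis" if "p \<in> sym_dual Basis" for d p
    using pullback_in_sym_dual_degree[OF hom_component_in_sym_dual_degree[OF that]]
    by (simp add: sym_dual_degree_iff)
  then show ?thesis
    unfolding sym_bracket_def hom_bracket_def using assms
    by (auto intro!: poly.subspace_sum poly.subspace_diff poly.subspace_scale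
        subspace_sym_dual poly.subspace_0)
qed

text \<open>
  Only the terms of the double sum with both indices equal to \<open>d\<close> have a component of degree \<open>d\<close>, since
  \<open>\<phi>\<^sup>*\<close> preserves degrees. If \<open>d\<close> is not a degree of \<open>f\<close> or of \<open>g\<close>, this term is missing from the sum,
  but then it is zero.
\<close>

lemma hom_component_bracket:
  assumes f: "f \<in> sym_dual Basis" and g: "g \<in> sym_dual Basis"
  shows "hom_component d (bracket f g) =
    poly_scale (eval_at d g) (pull (hom_component d f)) - poly_scale (eval_at d f) (pull (hom_component d g))"
    (is "_ = ?R")
proof -
  let ?T = "\<lambda>a b. hom_bracket scale Basis \<phi> w a b (hom_component a f) (hom_component b g)"
  have "hom_component d (?T a b) = (if a = d then if b = d then ?R else 0 else 0)" for a b
    using hom_component_of_homogeneous[OF pullback_in_sym_dual_degree[OF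
          hom_component_in_sym_dual_degree[OF f]], of d scale \<phi> a]
      hom_component_of_homogeneous[OF pullback_in_sym_dual_degree[OF
          hom_component_in_sym_dual_degree[OF g]], of d scale \<phi> b]
    by (auto simp: hom_bracket_def eval_at_def)
  then have "hom_component d (bracket f g) =
      (\<Sum>a\<in>degrees f. \<Sum>b\<in>degrees g. if a = d then if b = d then ?R else 0 else 0)"
    by (simp add: sym_bracket_def hom_component_sum)
  also have "\<dots> = (if d \<in> degrees f then if d \<in> degrees g then ?R else 0 else 0)"
  proof -
    \<comment> \<open>The outer condition has to leave the inner sum before each sum is one over a single index.\<close>
    have "(\<Sum>b\<in>degrees g. if a = d then if b = d then ?R else 0 else 0) =
        (if a = d then if d \<in> degrees g then ?R else 0 else 0)" for a
      by (simp add: finite_degrees sum.delta)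
    then show ?thesis
      by (simp add: finite_degrees sum.delta)
  qed
  also have "\<dots> = ?R"
    using hom_component_eq_0_iff[of d f] hom_component_eq_0_iff[of d g] by (auto simp: eval_at_def)
  finally show ?thesis .
qed

lemma poly_at_pull:
  assumes "p \<in> sym_dual Basis"
  shows "poly_at scale Basis (pull (hom_component d p)) w = c ^ d * eval_at d p"
proof -
  have hom: "hom_component d p \<in> sym_dual_degree Basis d"
    by (rule hom_component_in_sym_dual_degree) (rule assms)
  then show ?thesis
    by (simp add: poly_at_pullback linear_map sym_dual_degree_iff eigen
        poly_at_scale_homogeneous[OF hom] eval_at_def)
qed

text \<open>
  Both terms of the bracket take the value \<open>c\<^sup>d f(w) g(w)\<close> at \<open>w\<close>, by \<open>poly_at_pull\<close>.
\<close>

lemma eval_at_bracket: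
  assumes "f \<in> sym_dual Basis" "g \<in> sym_dual Basis"
  shows "eval_at d (bracket f g) = 0"
  using assms by (simp add: eval_at_def[of _ "bracket f g"] hom_component_bracket poly_at_pull)

text \<open>
  Of the two terms of the outer bracket, the one with coefficient \<open>[g, h](w)\<close> vanishes. The remaining
  one, expanded, is a difference whose cyclic sum over \<open>f, g, h\<close> telescopes.
\<close>

lemma hom_component_bracket_bracket:
  assumes "f \<in> sym_dual Basis" "g \<in> sym_dual Basis" "h \<in> sym_dual Basis"
  shows "hom_component d (bracket f (bracket g h)) =
    poly_scale (eval_at d f * eval_at d g) (pull (pull (hom_component d h))) -
    poly_scale (eval_at d f * eval_at d h) (pull (pull (hom_component d g)))"
  using assms
  by (simp add: hom_component_bracket bracket_in_sym_dual eval_at_bracket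
      poly.scale_right_diff_distrib)

lemma lie_algebra_bracket: "lie_algebra poly_scale (sym_dual Basis) bracket"
proof unfold_locales
  fix x y z :: "('v, 'k) polynomial" and a :: 'k
  assume x: "x \<in> sym_dual Basis"
  show "bracket x x = 0"
    by (rule poly_eqI_hom_component) (simp add: hom_component_bracket x)
  assume y: "y \<in> sym_dual Basis"
  have scale: "poly_scale a p \<in> sym_dual Basis" if "p \<in> sym_dual Basis" for p
    using that by (rule poly.subspace_scale[OF subspace_sym_dual])
  show "bracket x y \<in> sym_dual Basis"
    using x y by (rule bracket_in_sym_dual)
  show "bracket (poly_scale a x) y = poly_scale a (bracket x y)"
    "bracket x (poly_scale a y) = poly_scale a (bracket x y)"
    by (rule poly_eqI_hom_component, simp add: hom_component_bracket x y scale
        poly.scale_right_diff_distrib mult.commute)+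
  assume z: "z \<in> sym_dual Basis"
  have add: "p + q \<in> sym_dual Basis" if "p \<in> sym_dual Basis" "q \<in> sym_dual Basis"
    for p q :: "('v, 'k) polynomial"
    using that by (rule poly.subspace_add[OF subspace_sym_dual])
  show "bracket (x + y) z = bracket x z + bracket y z"
    "bracket x (y + z) = bracket x y + bracket x z"
    by (rule poly_eqI_hom_component, simp add: hom_component_bracket x y z add
        poly.scale_left_distrib poly.scale_right_distrib)+
  show "bracket x (bracket y z) + bracket y (bracket z x) + bracket z (bracket x y) = 0"
    by (rule poly_eqI_hom_component)
      (simp add: hom_component_bracket_bracket x y z mult.commute)
qed (rule subspace_sym_dual)

sublocale lie: lie_algebra poly_scale "sym_dual Basis" bracket
  by (rule lie_algebra_bracket)

text \<open>
  The right-hand side is a subspace on which the bracket vanishes, since each term of the bracket has the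
  value at \<open>w\<close> of one argument as a factor.
\<close>

lemma derived_algebra_subset:
  "lie.derived_series 1 \<subseteq> {p \<in> sym_dual Basis. \<forall>d. eval_at d p = 0}" (is "_ \<subseteq> ?K")
proof -
  have "poly.subspace ?K"
    using subspace_sym_dual[of Basis] by (auto simp: poly.subspace_def)
  moreover have "{bracket x y | x y. x \<in> sym_dual Basis \<and> y \<in> sym_dual Basis} \<subseteq> ?K"
    by (auto simp: bracket_in_sym_dual eval_at_bracket)
  ultimately show ?thesis
    by (simp add: poly.span_minimal)
qed

lemma solvable_bracket: "lie.solvable"
proof -
  have "bracket x y = 0" if "x \<in> lie.derived_series 1" "y \<in> lie.derived_series 1" for x y
  proof (rule poly_eqI_hom_component)
    fix d
    have "x \<in> sym_dual Basis" "y \<in> sym_dual Basis" "eval_at d x = 0" "eval_at d y = 0"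
      using that derived_algebra_subset by blast+
    then show "hom_component d (bracket x y) = hom_component d 0"
      by (simp add: hom_component_bracket)
  qed
  then have "{bracket x y | x y. x \<in> lie.derived_series 1 \<and> y \<in> lie.derived_series 1} \<subseteq> {0}"
    by auto
  then have "lie.derived_series (Suc 1) = {0}"
    using poly.span_minimal[OF _ poly.subspace_single_0] poly.span_zero
    by (simp only: lie.derived_series.simps) blast
  then show ?thesis
    unfolding lie.solvable_def by blast
qed

lemma infinite_dimensional_sym_dual:
  assumes b: "b \<in> Basis"
  shows "lie.infinite_dimensional"
  unfolding lie.infinite_dimensional_def
proof
  assume "\<exists>B. finite B \<and> B \<subseteq> sym_dual Basis \<and> poly.span B = (sym_dual Basis :: ('v, 'k) polynomial set)"
  then obtain B where B: "finite B" "poly.span B = (sym_dual Basis :: ('v, 'k) polynomial set)"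
    by blast
  define D where "D = (\<Union>p\<in>B. degrees p)"
  have "finite D"
    by (simp add: D_def B finite_degrees)
  \<comment> \<open>The \<open>n\<close>-th power of the variable \<open>b\<close> has degree \<open>n\<close>, so it is not in the span of \<open>B\<close>.\<close>
  then obtain n where n: "n \<notin> D"
    using ex_new_if_finite infinite_UNIV_nat by blast
  let ?p = "Poly_Mapping.single (Poly_Mapping.single b n) 1 :: ('v, 'k) polynomial"
  have "poly.span B \<subseteq> {p. degrees p \<subseteq> D}"
    by (rule poly.span_minimal) (auto simp: D_def subspace_degrees)
  moreover have "?p \<in> sym_dual Basis"
    using b by (auto simp: sym_dual_def)
  moreover have "n \<in> degrees ?p"
    by (simp add: degrees_def monom_degree_def)
  ultimately show False
    using n B by auto
qed

end

theorem corollary2p2: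
  fixes scale :: "'k::field \<Rightarrow> 'v::ab_group_add \<Rightarrow> 'v"
    and Basis :: "'v set" and \<phi> :: "'v \<Rightarrow> 'v" and w :: 'v
  assumes "finite_dimensional_vector_space scale Basis"
    and "Vector_Spaces.linear scale scale \<phi>"
    and "w \<noteq> 0" and "\<exists>c. \<phi> w = scale c w"
  shows "lie_algebra poly_scale (sym_dual Basis) (sym_bracket scale Basis \<phi> w)
    \<and> lie_algebra.solvable poly_scale (sym_dual Basis) (sym_bracket scale Basis \<phi> w)
    \<and> lie_algebra.infinite_dimensional poly_scale (sym_dual Basis :: ('v, 'k) polynomial set)"
proof -
  obtain c where "\<phi> w = scale c w"
    using assms(4) by blast
  then interpret eigenvector_bracket scale Basis \<phi> w c
    using assms(1,2) by (simp add: eigenvector_bracket_def eigenvector_bracket_axioms_def)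
  have "Basis \<noteq> {}"
    using span_Basis assms(3) by auto
  then show ?thesis
    using lie_algebra_bracket solvable_bracket infinite_dimensional_sym_dual by blast
qed

end
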